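(* Let $n\in\mathbb{N}$, let $\mathcal{D}$ be a probability distribution with full support on $\mathcal{G}_n$, and let $F\sim\mathcal{D}$. Then the random graph embedding $\varphi_F:\mathcal{G}_n\to\mathbb{R}^{\mathcal{G}_n}$, $\varphi_F(G)=\hom(F,G)\,e_F$, and the corresponding kernel $(G,G')\mapsto\langle\varphi_F(G),\varphi_F(G')\rangle$ are expectation-complete on $\mathcal{G}_n$.
   Context: Graphs are finite, undirected and simple, with at least one vertex. $\mathcal{G}_n$ is the set of all graphs with at most $n$ vertices, considered up to isomorphism (one representative per isomorphism class), so that $\mathcal{G}_n$ is finite. $\hom(F,G)$ is the number of homomorphisms from $F$ to $G$, i.e. maps $V(F)\to V(G)$ sending edges to edges. $e_F\in\mathbb{R}^{\mathcal{G}_n}$ is the standard basis vector indexed by $F$. $\mathcal{D}$ has full support on $\mathcal{G}_n$ if every element of $\mathcal{G}_n$ has nonzero probability. A map $\varphi$ on a set of graphs is complete if it takes equal values on isomorphic graphs and different values on non-isomorphic graphs. A random graph embedding $\varphi_X$, parameterised by a random variable $X$, is expectation-complete on $\mathcal{G}_n$ if the map $G\mapsto\mathbb{E}_X[\varphi_X(G)]$ is complete on $\mathcal{G}_n$; the corresponding kernel $k_X(G,G')=\langle\varphi_X(G),\varphi_X(G')\rangle$ is called expectation-complete if $\varphi_X$ is expectation-complete. *)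

theory Defs
  imports "HOL-Probability.Probability"
begin

text \<open>A finite simple undirected graph is a pair of a finite nonempty vertex set and a set of
  two-element subsets of it.\<close>

type_synonym 'a ugraph = "'a set \<times> 'a set set"

abbreviation verts :: "'a ugraph \<Rightarrow> 'a set" where "verts \<equiv> fst"

abbreviation edges :: "'a ugraph \<Rightarrow> 'a set set" where "edges \<equiv> snd"

definition simple_graph :: "'a ugraph \<Rightarrow> bool" where
  "simple_graph G \<longleftrightarrow> finite (verts G) \<and> verts G \<noteq> {} \<and>
     (\<forall>e\<in>edges G. e \<subseteq> verts G \<and> card e = 2)"

definition graph_iso :: "'a ugraph \<Rightarrow> 'b ugraph \<Rightarrow> bool" where
  "graph_iso G H \<longleftrightarrow> (\<exists>f. bij_betw f (verts G) (verts H) \<and>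
     (\<forall>u\<in>verts G. \<forall>v\<in>verts G. {u, v} \<in> edges G \<longleftrightarrow> {f u, f v} \<in> edges H))"

text \<open>Homomorphisms are extensional functions, so that two maps that differ only outside the
  vertex set of the source are not counted twice.\<close>

definition homs :: "'a ugraph \<Rightarrow> 'b ugraph \<Rightarrow> ('a \<Rightarrow> 'b) set" where
  "homs F G = {f \<in> verts F \<rightarrow>\<^sub>E verts G. \<forall>e\<in>edges F. f ` e \<in> edges G}"

definition hom_count :: "'a ugraph \<Rightarrow> 'b ugraph \<Rightarrow> nat" where
  "hom_count F G = card (homs F G)"

text \<open>Every finite graph is isomorphic to one whose vertices are natural numbers.\<close>

definition graphs_upto :: "nat \<Rightarrow> nat ugraph set" where
  "graphs_upto n = {G. simple_graph G \<and> card (verts G) \<le> n}"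

text \<open>\<open>Gn\<close> contains exactly one representative of each isomorphism class of graphs with at most
  \<open>n\<close> vertices.\<close>

definition iso_representatives :: "nat \<Rightarrow> nat ugraph set \<Rightarrow> bool" where
  "iso_representatives n Gn \<longleftrightarrow>
     Gn \<subseteq> graphs_upto n \<and> (\<forall>G\<in>graphs_upto n. \<exists>!H. H \<in> Gn \<and> graph_iso G H)"

definition complete_on :: "'a ugraph set \<Rightarrow> ('a ugraph \<Rightarrow> 'b) \<Rightarrow> bool" where
  "complete_on S \<phi> \<longleftrightarrow>
     (\<forall>G\<in>S. \<forall>H\<in>S. (graph_iso G H \<longrightarrow> \<phi> G = \<phi> H) \<and> (\<not> graph_iso G H \<longrightarrow> \<phi> G \<noteq> \<phi> H))"

text \<open>The space of real vectors indexed by a finite set \<open>I\<close> is \<open>I \<rightarrow>\<^sub>E UNIV\<close>; its expectations are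
  taken componentwise.\<close>

definition basis_vec :: "'i set \<Rightarrow> 'i \<Rightarrow> 'i \<Rightarrow> real" where
  "basis_vec I j = (\<lambda>i\<in>I. if i = j then 1 else 0)"

definition scale_vec :: "'i set \<Rightarrow> real \<Rightarrow> ('i \<Rightarrow> real) \<Rightarrow> 'i \<Rightarrow> real" where
  "scale_vec I c v = (\<lambda>i\<in>I. c * v i)"

definition inner_vec :: "'i set \<Rightarrow> ('i \<Rightarrow> real) \<Rightarrow> ('i \<Rightarrow> real) \<Rightarrow> real" where
  "inner_vec I v w = (\<Sum>i\<in>I. v i * w i)"

definition expectation_vec :: "'w measure \<Rightarrow> 'i set \<Rightarrow> ('w \<Rightarrow> 'i \<Rightarrow> real) \<Rightarrow> 'i \<Rightarrow> real" where
  "expectation_vec M I Y = (\<lambda>i\<in>I. \<integral>\<omega>. Y \<omega> i \<partial>M)"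

text \<open>Integrability is required explicitly because the Bochner integral of a non-integrable
  function is 0 by convention.\<close>

definition random_graph_embedding ::
  "'w measure \<Rightarrow> ('w \<Rightarrow> 'x) \<Rightarrow> 'a ugraph set \<Rightarrow> 'i set \<Rightarrow> ('x \<Rightarrow> 'a ugraph \<Rightarrow> 'i \<Rightarrow> real) \<Rightarrow> bool"
where
  "random_graph_embedding M X S I \<phi> \<longleftrightarrow> prob_space M \<and> finite I \<and>
     (\<forall>G\<in>S. (\<forall>\<omega>\<in>space M. \<phi> (X \<omega>) G \<in> I \<rightarrow>\<^sub>E UNIV) \<and>
             (\<forall>i\<in>I. integrable M (\<lambda>\<omega>. \<phi> (X \<omega>) G i)))"

definition expectation_complete_embedding ::
  "'w measure \<Rightarrow> ('w \<Rightarrow> 'x) \<Rightarrow> 'a ugraph set \<Rightarrow> 'i set \<Rightarrow> ('x \<Rightarrow> 'a ugraph \<Rightarrow> 'i \<Rightarrow> real) \<Rightarrow> bool"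
where
  "expectation_complete_embedding M X S I \<phi> \<longleftrightarrow> random_graph_embedding M X S I \<phi> \<and>
     complete_on S (\<lambda>G. expectation_vec M I (\<lambda>\<omega>. \<phi> (X \<omega>) G))"

definition kernel_of ::
  "'i set \<Rightarrow> ('x \<Rightarrow> 'a ugraph \<Rightarrow> 'i \<Rightarrow> real) \<Rightarrow> 'x \<Rightarrow> 'a ugraph \<Rightarrow> 'a ugraph \<Rightarrow> real" where
  "kernel_of I \<phi> x G H = inner_vec I (\<phi> x G) (\<phi> x H)"

text \<open>Expectation-completeness of a kernel refers to the embedding \<open>\<phi>\<close> that the kernel comes
  from.\<close>

definition expectation_complete_kernel ::
  "'w measure \<Rightarrow> ('w \<Rightarrow> 'x) \<Rightarrow> 'a ugraph set \<Rightarrow> 'i set \<Rightarrow> ('x \<Rightarrow> 'a ugraph \<Rightarrow> 'i \<Rightarrow> real) \<Rightarrow>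
    ('x \<Rightarrow> 'a ugraph \<Rightarrow> 'a ugraph \<Rightarrow> real) \<Rightarrow> bool"
where
  "expectation_complete_kernel M X S I \<phi> k \<longleftrightarrow>
     (\<forall>\<omega>\<in>space M. \<forall>G\<in>S. \<forall>H\<in>S. k (X \<omega>) G H = kernel_of I \<phi> (X \<omega>) G H) \<and>
     expectation_complete_embedding M X S I \<phi>"

definition full_support :: "'a pmf \<Rightarrow> 'a set \<Rightarrow> bool" where
  "full_support D S \<longleftrightarrow> (\<forall>F\<in>S. pmf D F \<noteq> 0)"

definition hom_embedding :: "'a ugraph set \<Rightarrow> 'a ugraph \<Rightarrow> 'a ugraph \<Rightarrow> 'a ugraph \<Rightarrow> real" where
  "hom_embedding I F G = scale_vec I (real (hom_count F G)) (basis_vec I F)"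

end

(* The integral of the F-component of the embedding of G is pmf D F * hom(F, G), so by full support
   the expectation determines hom(F, G) for all graphs F on at most n vertices.  Grouping the
   homomorphisms by their kernel gives hom(F, G) as the sum of inj(F / ~, G) over all equivalence
   relations ~ on the vertices of F; by induction on the number of vertices of F the numbers
   inj(F, G) are determined as well.  If inj(F, G) = inj(F, H) for all F, then F = G and F = H give
   injective homomorphisms in both directions, so G and H are isomorphic (Lovasz). *)
theory Submission
  imports Defs
begin

section \<open>Isomorphism invariance of hom(F, G) in F\<close>

section \<open>Isomorphisms\<close>

lemma graph_iso_refl: "graph_iso G G"
  unfolding graph_iso_def by (rule exI[of _ "\<lambda>x. x"]) (auto simp: bij_betw_def)

lemma graph_iso_sym:
  assumes "graph_iso G H"
  shows "graph_iso H G"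
proof -
  obtain f where f: "bij_betw f (verts G) (verts H)"
    and fe: "\<And>u v. u \<in> verts G \<Longrightarrow> v \<in> verts G \<Longrightarrow> {u, v} \<in> edges G \<longleftrightarrow> {f u, f v} \<in> edges H"
    using assms unfolding graph_iso_def by blast
  let ?g = "inv_into (verts G) f"
  have g: "bij_betw ?g (verts H) (verts G)"
    using f by (rule bij_betw_inv_into)
  have "{u, v} \<in> edges H \<longleftrightarrow> {?g u, ?g v} \<in> edges G" if "u \<in> verts H" "v \<in> verts H" for u v
    using fe[of "?g u" "?g v"] that bij_betw_inv_into_right[OF f] bij_betwE[OF g] by auto
  with g show ?thesis
    unfolding graph_iso_def by blast
qed

lemma simple_graph_edgeE:
  assumes "simple_graph G" "e \<in> edges G"
  obtains u v where "e = {u, v}" "u \<noteq> v" "u \<in> verts G" "v \<in> verts G"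
proof -
  have "e \<subseteq> verts G" "card e = 2"
    using assms unfolding simple_graph_def by auto
  then show ?thesis
    using that by (auto simp: card_2_iff)
qed

lemma simple_graph_finite_edges: "simple_graph G \<Longrightarrow> finite (edges G)"
  unfolding simple_graph_def by (meson Pow_iff finite_Pow_iff finite_subset subsetI)

lemma finite_homs: "finite (verts F) \<Longrightarrow> finite (verts G) \<Longrightarrow> finite (homs F G)"
  unfolding homs_def by (rule finite_subset[of _ "verts F \<rightarrow>\<^sub>E verts G"]) (auto intro: finite_PiE)

text \<open>Precomposition with an isomorphism \<open>b\<close> from \<open>F\<close> to
  \<open>F'\<close> sends homomorphisms to homomorphisms and is injective because \<open>b\<close>
  is onto. The reverse inequality comes from the inverse isomorphism.\<close>

lemma hom_count_le_of_iso:
  assumes "graph_iso F F'" "simple_graph F" "simple_graph F'" "simple_graph G"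
  shows "hom_count F' G \<le> hom_count F G"
proof -
  obtain b where b: "bij_betw b (verts F) (verts F')"
    and be: "\<And>u v. u \<in> verts F \<Longrightarrow> v \<in> verts F \<Longrightarrow> {u, v} \<in> edges F \<longleftrightarrow> {b u, b v} \<in> edges F'"
    using assms(1) unfolding graph_iso_def by blast
  let ?p = "\<lambda>f. \<lambda>v\<in>verts F. f (b v)"
  have img: "b ` verts F = verts F'"
    using b by (simp add: bij_betw_def)
  have "inj_on ?p (homs F' G)"
  proof (rule inj_onI)
    fix f g assume fg: "f \<in> homs F' G" "g \<in> homs F' G" and eq: "?p f = ?p g"
    have "f (b v) = g (b v)" if "v \<in> verts F" for v
      using fun_cong[OF eq, of v] that by simp
    then have "\<forall>w\<in>b ` verts F. f w = g w"
      by simp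
    moreover have "f \<in> verts F' \<rightarrow>\<^sub>E verts G" "g \<in> verts F' \<rightarrow>\<^sub>E verts G"
      using fg by (simp_all add: homs_def)
    ultimately show "f = g"
      unfolding img by (metis PiE_ext)
  qed
  moreover have "?p ` homs F' G \<subseteq> homs F G"
  proof (rule image_subsetI)
    fix f assume f: "f \<in> homs F' G"
    have "?p f ` e \<in> edges G" if eF: "e \<in> edges F" for e
    proof -
      obtain u v where e: "e = {u, v}" "u \<in> verts F" "v \<in> verts F"
        using simple_graph_edgeE[OF assms(2) eF] by metis
      have "{b u, b v} \<in> edges F'"
        using be[OF e(2,3)] eF e(1) by simp
      then have "f ` {b u, b v} \<in> edges G"
        using f unfolding homs_def by blast
      then show ?thesis
        using e by simp
    qed
    moreover have "?p f \<in> verts F \<rightarrow>\<^sub>E verts G"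
      using f img unfolding homs_def by auto
    ultimately show "?p f \<in> homs F G"
      unfolding homs_def by blast
  qed
  moreover have "finite (homs F G)"
    using assms by (simp add: finite_homs simple_graph_def)
  ultimately show ?thesis
    unfolding hom_count_def by (metis card_inj_on_le)
qed

lemma hom_count_cong_iso:
  assumes "graph_iso F F'" "simple_graph F" "simple_graph F'" "simple_graph G"
  shows "hom_count F G = hom_count F' G"
  using hom_count_le_of_iso[OF assms]
    hom_count_le_of_iso[OF graph_iso_sym[OF assms(1)] assms(3,2,4)]
  by (rule le_antisym[rotated])

text \<open>Since \<open>f\<close> is injective on the vertices, taking images is injective on
  vertex subsets, so no non-edge is mapped onto the image of an edge.\<close>

lemma graph_iso_relabel:
  assumes G: "simple_graph G" and f: "bij_betw f (verts G) W"
  shows "graph_iso G (W, (`) f ` edges G)"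
proof -
  have inj: "inj_on f (verts G)"
    using f by (simp add: bij_betw_def)
  have "edges G \<subseteq> Pow (verts G)"
    using G by (auto simp: simple_graph_def)
  then have "{u, v} \<in> edges G \<longleftrightarrow> f ` {u, v} \<in> (`) f ` edges G"
    if "u \<in> verts G" "v \<in> verts G" for u v
    using inj_on_image_mem_iff[OF inj_on_image_Pow[OF inj], of "{u, v}" "edges G"] that by simp
  with f show ?thesis
    unfolding graph_iso_def by auto
qed

section \<open>Decomposition of hom(F, G) over the quotients of F\<close>

section \<open>Kernels of homomorphisms\<close>

text \<open>The kernel of \<open>f\<close> is encoded by the map that sends each vertex to a chosen representative of
  its class, so that quotients of a graph live on subsets of its own vertex set.\<close>

definition kernel_rep :: "'a set \<Rightarrow> ('a \<Rightarrow> 'b) \<Rightarrow> 'a \<Rightarrow> 'a" where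
  "kernel_rep V f = (\<lambda>v\<in>V. SOME u. u \<in> V \<and> f u = f v)"

text \<open>As fixed points of \<open>kernel_rep\<close>, these maps are in bijection with the
  equivalence relations on \<open>V\<close>.\<close>

definition kernel_reps :: "'a set \<Rightarrow> ('a \<Rightarrow> 'a) set" where
  "kernel_reps V = {r \<in> V \<rightarrow>\<^sub>E V. kernel_rep V r = r}"

text \<open>An edge inside one class becomes a singleton, that is, a loop; the quotient of a simple
  graph may therefore fail to be simple.\<close>

definition quotient_graph :: "('a \<Rightarrow> 'a) \<Rightarrow> 'a ugraph \<Rightarrow> 'a ugraph" where
  "quotient_graph r F = (r ` verts F, (`) r ` edges F)"

definition injs :: "'a ugraph \<Rightarrow> 'b ugraph \<Rightarrow> ('a \<Rightarrow> 'b) set" where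
  "injs F G = {f \<in> homs F G. inj_on f (verts F)}"

lemma kernel_rep:
  assumes "v \<in> V"
  shows "kernel_rep V f v \<in> V" "f (kernel_rep V f v) = f v"
  using someI[of "\<lambda>u. u \<in> V \<and> f u = f v" v] assms by (auto simp: kernel_rep_def)

lemma kernel_rep_eq_iff:
  assumes "u \<in> V" "v \<in> V"
  shows "kernel_rep V f u = kernel_rep V f v \<longleftrightarrow> f u = f v"
proof
  show "f u = f v" if "kernel_rep V f u = kernel_rep V f v"
    using kernel_rep(2)[OF assms(1), of f] kernel_rep(2)[OF assms(2), of f] that by metis
  show "kernel_rep V f u = kernel_rep V f v" if "f u = f v"
    using that assms by (simp add: kernel_rep_def)
qed

text \<open>The choice made by \<open>SOME\<close> depends only on the predicate, and equal kernels
  give equal predicates; this makes the representatives canonical.\<close>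

lemma kernel_rep_cong:
  assumes "\<And>u v. u \<in> V \<Longrightarrow> v \<in> V \<Longrightarrow> f u = f v \<longleftrightarrow> g u = g v"
  shows "kernel_rep V f = kernel_rep V g"
proof
  fix v
  have "(\<lambda>u. u \<in> V \<and> f u = f v) = (\<lambda>u. u \<in> V \<and> g u = g v)" if "v \<in> V"
    using assms that by blast
  then show "kernel_rep V f v = kernel_rep V g v"
    by (auto simp: kernel_rep_def)
qed

lemma kernel_rep_in_kernel_reps: "kernel_rep V f \<in> kernel_reps V"
proof -
  have "kernel_rep V f \<in> V \<rightarrow>\<^sub>E V"
    using kernel_rep(1)[of _ V f] by (auto simp: kernel_rep_def)
  moreover have "kernel_rep V (kernel_rep V f) = kernel_rep V f"
    by (rule kernel_rep_cong) (simp add: kernel_rep_eq_iff)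
  ultimately show ?thesis
    by (simp add: kernel_reps_def)
qed

lemma kernel_reps_idem:
  assumes "r \<in> kernel_reps V" "v \<in> V"
  shows "r v \<in> V" "r (r v) = r v"
  using kernel_rep[OF assms(2), of r] assms(1) by (auto simp: kernel_reps_def)

lemma finite_kernel_reps: "finite V \<Longrightarrow> finite (kernel_reps V)"
  unfolding kernel_reps_def by (rule finite_subset[of _ "V \<rightarrow>\<^sub>E V"]) (auto intro: finite_PiE)

lemma id_in_kernel_reps: "(\<lambda>v\<in>V. v) \<in> kernel_reps V"
proof -
  have "kernel_rep V (\<lambda>v. v) = (\<lambda>v\<in>V. v)"
    using kernel_rep(2)[of _ V "\<lambda>v. v"] by (auto simp: kernel_rep_def)
  then show ?thesis
    using kernel_rep_in_kernel_reps[of V "\<lambda>v. v"] by simp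
qed

text \<open>An idempotent map onto \<open>V\<close> is the identity. The strict drop in size drives
  the induction on the number of vertices.\<close>

lemma card_kernel_reps_image:
  assumes "finite V" "r \<in> kernel_reps V" "r \<noteq> (\<lambda>v\<in>V. v)"
  shows "card (r ` V) < card V"
proof -
  have "r ` V \<noteq> V"
  proof
    assume onto: "r ` V = V"
    have "r v = v" if v: "v \<in> V" for v
    proof -
      obtain u where "u \<in> V" "v = r u"
        using v onto by blast
      then show ?thesis
        using kernel_reps_idem(2)[OF assms(2)] by simp
    qed
    moreover have "r \<in> V \<rightarrow>\<^sub>E V"
      using assms(2) by (simp add: kernel_reps_def)
    ultimately have "r = (\<lambda>v\<in>V. v)"
      by (intro PiE_ext[of _ V "\<lambda>_. V"]) auto
    with assms(3) show False ..
  qed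
  moreover have "r ` V \<subseteq> V"
    using kernel_reps_idem(1)[OF assms(2)] by blast
  ultimately show ?thesis
    using assms(1) by (metis psubsetI psubset_card_mono)
qed

lemma quotient_graph_id:
  assumes "simple_graph F"
  shows "quotient_graph (\<lambda>v\<in>verts F. v) F = F"
proof -
  have "(\<lambda>v\<in>verts F. v) ` e = e" if "e \<in> edges F" for e
  proof -
    have "e \<subseteq> verts F"
      using assms that by (simp add: simple_graph_def)
    then show ?thesis
      by (auto simp: image_iff)
  qed
  then have "(`) (\<lambda>v\<in>verts F. v) ` edges F = edges F"
    by simp
  then show ?thesis
    by (simp add: quotient_graph_def prod_eq_iff)
qed

text \<open>A homomorphism with kernel \<open>r\<close> factors uniquely through the quotient by
  \<open>r\<close>: restriction to the representatives gives the injective factor, and composition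
  with \<open>r\<close> recovers the homomorphism.\<close>

lemma bij_betw_homs_with_kernel:
  assumes F: "simple_graph F" and r: "r \<in> kernel_reps (verts F)"
  shows "bij_betw (\<lambda>f. restrict f (r ` verts F))
    {f \<in> homs F G. kernel_rep (verts F) f = r} (injs (quotient_graph r F) G)"
proof (rule bij_betw_byWitness[where f' = "\<lambda>g. \<lambda>v\<in>verts F. g (r v)"])
  let ?V = "verts F"
  have edge_sub: "e \<subseteq> ?V" if "e \<in> edges F" for e
    using F that by (simp add: simple_graph_def)
  note rV = kernel_reps_idem[OF r]
  show "\<forall>f\<in>{f \<in> homs F G. kernel_rep ?V f = r}. (\<lambda>v\<in>?V. restrict f (r ` ?V) (r v)) = f"
  proof
    fix f assume f: "f \<in> {f \<in> homs F G. kernel_rep ?V f = r}"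
    then have fr: "f (r v) = f v" if "v \<in> ?V" for v
      using kernel_rep(2)[OF that, of f] by simp
    have maps: "f \<in> ?V \<rightarrow>\<^sub>E verts G"
      using f by (simp add: homs_def)
    have "(\<lambda>v\<in>?V. restrict f (r ` ?V) (r v)) v = f v" for v
    proof (cases "v \<in> ?V")
      case True
      then show ?thesis
        using fr[OF True] by simp
    next
      \<comment> \<open>Both sides are \<open>undefined\<close> here, because homomorphisms are
        extensional.\<close>
      case False
      then show ?thesis
        using PiE_arb[OF maps False] by simp
    qed
    then show "(\<lambda>v\<in>?V. restrict f (r ` ?V) (r v)) = f"
      by (rule ext)
  qed
  show "\<forall>g\<in>injs (quotient_graph r F) G. restrict (\<lambda>v\<in>?V. g (r v)) (r ` ?V) = g"
  proof
    fix g assume "g \<in> injs (quotient_graph r F) G"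
    then have maps: "g \<in> r ` ?V \<rightarrow>\<^sub>E verts G"
      by (simp add: injs_def homs_def quotient_graph_def)
    have "restrict (\<lambda>v\<in>?V. g (r v)) (r ` ?V) w = g w" for w
    proof (cases "w \<in> r ` ?V")
      case True
      then have "w \<in> ?V" "r w = w"
        using rV by blast+
      with True show ?thesis
        by simp
    next
      case False
      then show ?thesis
        using PiE_arb[OF maps False] by simp
    qed
    then show "restrict (\<lambda>v\<in>?V. g (r v)) (r ` ?V) = g"
      by (rule ext)
  qed
  show "(\<lambda>f. restrict f (r ` ?V)) ` {f \<in> homs F G. kernel_rep ?V f = r}
      \<subseteq> injs (quotient_graph r F) G"
  proof (rule image_subsetI)
    fix f assume f: "f \<in> {f \<in> homs F G. kernel_rep ?V f = r}"
    have fr: "f (r v) = f v" if "v \<in> ?V" for v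
      using kernel_rep(2)[OF that, of f] f by simp
    have maps: "restrict f (r ` ?V) \<in> r ` ?V \<rightarrow>\<^sub>E verts G"
      using f rV(1) by (auto simp: homs_def)
    have inj: "inj_on (restrict f (r ` ?V)) (r ` ?V)"
    proof (rule inj_onI)
      fix x y assume xy: "x \<in> r ` ?V" "y \<in> r ` ?V"
        and eq: "restrict f (r ` ?V) x = restrict f (r ` ?V) y"
      from xy obtain u v where uv: "u \<in> ?V" "v \<in> ?V" "x = r u" "y = r v"
        by blast
      have "f u = f v"
        using eq uv fr by simp
      then have "kernel_rep ?V f u = kernel_rep ?V f v"
        using uv by (simp add: kernel_rep_eq_iff)
      then show "x = y"
        using uv f by simp
    qed
    have "restrict f (r ` ?V) ` (r ` e) \<in> edges G" if e: "e \<in> edges F" for e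
    proof -
      have "restrict f (r ` ?V) ` (r ` e) = f ` e"
        unfolding image_image using edge_sub[OF e] fr by (intro image_cong) auto
      then show ?thesis
        using f e by (simp add: homs_def)
    qed
    with maps inj show "restrict f (r ` ?V) \<in> injs (quotient_graph r F) G"
      by (auto simp: injs_def homs_def quotient_graph_def)
  qed
  show "(\<lambda>g. \<lambda>v\<in>?V. g (r v)) ` injs (quotient_graph r F) G
      \<subseteq> {f \<in> homs F G. kernel_rep ?V f = r}"
  proof (rule image_subsetI)
    fix g assume "g \<in> injs (quotient_graph r F) G"
    then have maps: "g \<in> r ` ?V \<rightarrow>\<^sub>E verts G" and inj: "inj_on g (r ` ?V)"
      and ge: "\<And>e. e \<in> edges F \<Longrightarrow> g ` r ` e \<in> edges G"
      by (auto simp: injs_def homs_def quotient_graph_def)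
    let ?f = "\<lambda>v\<in>?V. g (r v)"
    \<comment> \<open>As \<open>g\<close> is injective on the image of \<open>r\<close>, composing
      with it identifies no further vertices.\<close>
    have "kernel_rep ?V ?f = kernel_rep ?V r"
      using inj by (intro kernel_rep_cong) (auto simp: inj_on_eq_iff)
    then have "kernel_rep ?V ?f = r"
      using r by (simp add: kernel_reps_def)
    moreover have "?f ` e \<in> edges G" if e: "e \<in> edges F" for e
    proof -
      have "?f ` e = g ` r ` e"
        unfolding image_image using edge_sub[OF e] by (intro image_cong) auto
      then show ?thesis
        using ge e by simp
    qed
    moreover have "?f \<in> ?V \<rightarrow>\<^sub>E verts G"
      using maps by auto
    ultimately show "?f \<in> {f \<in> homs F G. kernel_rep ?V f = r}"
      by (simp add: homs_def)
  qed
qed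

lemma hom_count_eq_sum_injs:
  assumes F: "simple_graph F" and G: "simple_graph G"
  shows "hom_count F G = (\<Sum>r\<in>kernel_reps (verts F). card (injs (quotient_graph r F) G))"
proof -
  have fin: "finite (verts F)" "finite (homs F G)"
    using F G by (simp_all add: finite_homs simple_graph_def)
  have "kernel_rep (verts F) ` homs F G \<subseteq> kernel_reps (verts F)"
    using kernel_rep_in_kernel_reps by blast
  \<comment> \<open>Summing the constant 1 over the fibres of \<open>kernel_rep\<close> counts the
    homomorphisms by kernel.\<close>
  from sum.group[OF fin(2) finite_kernel_reps[OF fin(1)] this, of "\<lambda>_. 1::nat"]
  have "hom_count F G
      = (\<Sum>r\<in>kernel_reps (verts F). card {f \<in> homs F G. kernel_rep (verts F) f = r})"
    by (simp add: hom_count_def)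
  also have "\<dots> = (\<Sum>r\<in>kernel_reps (verts F). card (injs (quotient_graph r F) G))"
    by (intro sum.cong refl bij_betw_same_card[OF bij_betw_homs_with_kernel[OF F]])
  finally show ?thesis .
qed

section \<open>Separation of graphs by homomorphism counts\<close>

section \<open>Homomorphism counts determine a graph\<close>

text \<open>An injective map preserves the size of each edge, and edges of \<open>G\<close> have two
  elements, so a quotient with a loop has no injective homomorphism to \<open>G\<close>.\<close>

lemma injs_quotient_graph_loop:
  assumes F: "simple_graph F" and G: "simple_graph G"
    and "\<not> simple_graph (quotient_graph r F)"
  shows "injs (quotient_graph r F) G = {}"
proof (rule ccontr)
  assume "injs (quotient_graph r F) G \<noteq> {}"
  then obtain g where g: "inj_on g (r ` verts F)" "\<And>e. e \<in> edges F \<Longrightarrow> g ` r ` e \<in> edges G"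
    by (auto simp: injs_def homs_def quotient_graph_def)
  have "r ` e \<subseteq> r ` verts F \<and> card (r ` e) = 2" if e: "e \<in> edges F" for e
  proof -
    have sub: "r ` e \<subseteq> r ` verts F"
      using F e by (meson image_mono simple_graph_def)
    then have "card (g ` r ` e) = card (r ` e)"
      using g(1) by (meson card_image inj_on_subset)
    moreover have "card (g ` r ` e) = 2"
      using g(2)[OF e] G by (simp add: simple_graph_def)
    ultimately show ?thesis
      using sub by simp
  qed
  then have "simple_graph (quotient_graph r F)"
    using F by (auto simp: simple_graph_def quotient_graph_def)
  with assms(3) show False ..
qed

text \<open>In the sum over quotients of \<open>F\<close>, the identity contributes the injections
  from \<open>F\<close> itself. Every other quotient is smaller, hence covered by induction, or has
  a loop and contributes 0. Subtracting these terms isolates the injection count without explicit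
  Moebius coefficients.\<close>

lemma card_injs_eq:
  fixes F :: "'a ugraph" and G H :: "'b ugraph"
  assumes G: "simple_graph G" and H: "simple_graph H"
    and hom: "\<And>F :: 'a ugraph. simple_graph F \<Longrightarrow> card (verts F) \<le> n \<Longrightarrow>
      hom_count F G = hom_count F H"
    and "simple_graph F" "card (verts F) \<le> n"
  shows "card (injs F G) = card (injs F H)"
  using assms(4,5)
proof (induction "card (verts F)" arbitrary: F rule: less_induct)
  case (less F)
  let ?V = "verts F"
  let ?id = "\<lambda>v\<in>verts F. v"
  have fin: "finite ?V"
    using less.prems(1) by (simp add: simple_graph_def)
  note finR = finite_kernel_reps[OF fin]
  have "card (injs (quotient_graph r F) G) = card (injs (quotient_graph r F) H)"
    if r: "r \<in> kernel_reps ?V - {?id}" for r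
  proof (cases "simple_graph (quotient_graph r F)")
    case True
    have "card (verts (quotient_graph r F)) < card ?V"
      using card_kernel_reps_image[OF fin, of r] r by (simp add: quotient_graph_def)
    then show ?thesis
      using less.hyps[of "quotient_graph r F"] True less.prems(2) by simp
  next
    case False
    then show ?thesis
      using injs_quotient_graph_loop[OF less.prems(1) G False]
        injs_quotient_graph_loop[OF less.prems(1) H False] by simp
  qed
  then have "(\<Sum>r\<in>kernel_reps ?V - {?id}. card (injs (quotient_graph r F) G))
      = (\<Sum>r\<in>kernel_reps ?V - {?id}. card (injs (quotient_graph r F) H))"
    by (rule sum.cong[OF refl])
  \<comment> \<open>The term split off is the discrete relation, whose quotient is
    \<open>F\<close>.\<close>
  moreover have "hom_count F K
      = card (injs F K) + (\<Sum>r\<in>kernel_reps ?V - {?id}. card (injs (quotient_graph r F) K))"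
    if "simple_graph K" for K :: "'b ugraph"
    using hom_count_eq_sum_injs[OF less.prems(1) that]
      sum.remove[OF finR id_in_kernel_reps, of "\<lambda>r. card (injs (quotient_graph r F) K)"]
      quotient_graph_id[OF less.prems(1)]
    by simp
  ultimately show ?case
    using hom[OF less.prems] G H by simp
qed

lemma injs_card_le:
  assumes G: "simple_graph G" and H: "simple_graph H" and f: "f \<in> injs G H"
  shows "card (verts G) \<le> card (verts H)" "(`) f ` edges G \<subseteq> edges H"
    "card ((`) f ` edges G) = card (edges G)"
proof -
  have maps: "f ` verts G \<subseteq> verts H" and inj: "inj_on f (verts G)"
    using f by (auto simp: injs_def homs_def)
  show "card (verts G) \<le> card (verts H)"
    using card_inj_on_le[OF inj maps] H by (simp add: simple_graph_def)
  show "(`) f ` edges G \<subseteq> edges H"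
    using f by (auto simp: injs_def homs_def)
  have "edges G \<subseteq> Pow (verts G)"
    using G by (auto simp: simple_graph_def)
  then have "inj_on ((`) f) (edges G)"
    using inj_on_subset[OF inj_on_image_Pow[OF inj]] by blast
  then show "card ((`) f ` edges G) = card (edges G)"
    by (rule card_image)
qed

text \<open>An injective homomorphism need not reflect edges. Injections both ways force equal
  numbers of vertices and of edges, and by finiteness \<open>f\<close> is then onto for
  both.\<close>

lemma graph_iso_of_injs:
  assumes G: "simple_graph G" and H: "simple_graph H" and f: "f \<in> injs G H" and g: "g \<in> injs H G"
  shows "graph_iso G H"
proof -
  note fc = injs_card_le[OF G H f]
  note gc = injs_card_le[OF H G g]
  have inj: "inj_on f (verts G)"
    using f by (simp add: injs_def)
  have "card (verts G) = card (verts H)"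
    using fc(1) gc(1) by simp
  then have "f ` verts G = verts H"
    using f H card_image[OF inj]
    by (intro card_subset_eq) (auto simp: injs_def homs_def simple_graph_def)
  then have bij: "bij_betw f (verts G) (verts H)"
    using inj by (simp add: bij_betw_def)
  have "card (edges H) \<le> card (edges G)"
    using card_mono[OF simple_graph_finite_edges[OF G] gc(2)] gc(3) by simp
  then have onto: "(`) f ` edges G = edges H"
    using fc(2,3) card_seteq[OF simple_graph_finite_edges[OF H]] by metis
  then have "(verts H, (`) f ` edges G) = H"
    by (simp add: prod_eq_iff)
  then show ?thesis
    using graph_iso_relabel[OF G bij] by simp
qed

lemma id_in_injs:
  assumes "simple_graph G"
  shows "(\<lambda>v\<in>verts G. v) \<in> injs G G"
proof -
  have "(`) (\<lambda>v\<in>verts G. v) ` edges G = edges G"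
    using quotient_graph_id[OF assms] by (simp add: quotient_graph_def prod_eq_iff)
  then show ?thesis
    by (auto simp: injs_def homs_def inj_on_def)
qed

text \<open>The test graphs share the vertex type of \<open>G\<close> and \<open>H\<close>, since
  \<open>G\<close> and \<open>H\<close> themselves serve as test graphs.\<close>

theorem graph_iso_of_hom_count_eq:
  fixes G H :: "'a ugraph"
  assumes G: "simple_graph G" "card (verts G) \<le> n" and H: "simple_graph H" "card (verts H) \<le> n"
    and hom: "\<And>F :: 'a ugraph. simple_graph F \<Longrightarrow> card (verts F) \<le> n \<Longrightarrow>
      hom_count F G = hom_count F H"
  shows "graph_iso G H"
proof -
  have fin: "finite (injs G G)" "finite (injs H H)"
    using finite_homs[of G G] finite_homs[of H H] G(1) H(1)
    by (simp_all add: injs_def simple_graph_def)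
  have "card (injs G G) \<noteq> 0" "card (injs H H) \<noteq> 0"
    using fin id_in_injs[OF G(1)] id_in_injs[OF H(1)] by auto
  \<comment> \<open>With \<open>G\<close> as test graph, the identity on \<open>G\<close> yields an
    injection into \<open>H\<close>; with \<open>H\<close> as test graph, the identity on
    \<open>H\<close> yields one into \<open>G\<close>.\<close>
  then have "card (injs G H) \<noteq> 0" "card (injs H G) \<noteq> 0"
    using card_injs_eq[OF G(1) H(1) hom] G H by metis+
  then obtain f g where "f \<in> injs G H" "g \<in> injs H G"
    by (metis card.empty ex_in_conv)
  then show ?thesis
    using graph_iso_of_injs G H by blast
qed

section \<open>Finiteness of \<open>Gn\<close> and restriction of the test graphs to it\<close>

section \<open>Isomorphism representatives\<close>

lemma iso_representatives_unique:
  assumes "iso_representatives n Gn" "G \<in> Gn" "H \<in> Gn" "graph_iso G H"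
  shows "G = H"
  using assms graph_iso_refl[of G] unfolding iso_representatives_def by blast

text \<open>Members of \<open>Gn\<close> may use arbitrarily large numbers as vertices. Each is
  relabelled to an initial segment below \<open>n\<close>, where only finitely many graphs
  exist.\<close>

lemma finite_iso_representatives:
  assumes rep: "iso_representatives n Gn"
  shows "finite Gn"
proof -
  let ?C = "Pow {..<n} \<times> Pow (Pow {..<n}) :: nat ugraph set"
  have "\<exists>K\<in>?C. simple_graph K \<and> card (verts K) \<le> n \<and> graph_iso K G" if "G \<in> Gn" for G
  proof -
    have G: "simple_graph G" "card (verts G) \<le> n"
      using rep that by (auto simp: iso_representatives_def graphs_upto_def)
    then obtain f where f: "bij_betw f (verts G) {0..<card (verts G)}"
      using ex_bij_betw_finite_nat[of "verts G"] unfolding simple_graph_def by blast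
    let ?K = "({0..<card (verts G)}, (`) f ` edges G)"
    have img: "f ` verts G = {0..<card (verts G)}" and inj: "inj_on f (verts G)"
      using f by (simp_all add: bij_betw_def)
    have sub: "f ` e \<subseteq> {0..<card (verts G)} \<and> card (f ` e) = 2" if "e \<in> edges G" for e
    proof -
      have "e \<subseteq> verts G" "card e = 2"
        using G(1) that by (simp_all add: simple_graph_def)
      then show ?thesis
        using img card_image[OF inj_on_subset[OF inj]] by (metis image_mono)
    qed
    then have "simple_graph ?K"
      using G(1) by (simp add: simple_graph_def card_gt_0_iff)
    moreover have "?K \<in> ?C"
      using sub G(2) by fastforce
    moreover have "graph_iso ?K G"
      using graph_iso_relabel[OF G(1) f] by (rule graph_iso_sym)
    ultimately show ?thesis
      using G(2) by (intro bexI[of _ ?K] conjI) simp_all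
  qed
  then obtain k where k: "\<And>G. G \<in> Gn \<Longrightarrow>
      k G \<in> ?C \<and> simple_graph (k G) \<and> card (verts (k G)) \<le> n \<and> graph_iso (k G) G"
    by metis
  have "inj_on k Gn"
  proof (rule inj_onI)
    fix G H assume GH: "G \<in> Gn" "H \<in> Gn" "k G = k H"
    \<comment> \<open>\<open>G\<close> and \<open>H\<close> both represent the class of the common
      relabelled graph, so they coincide.\<close>
    then have "\<exists>!L. L \<in> Gn \<and> graph_iso (k G) L"
      using rep k[of G] unfolding iso_representatives_def graphs_upto_def by blast
    then show "G = H"
      using k[of G] k[of H] GH by metis
  qed
  moreover have "k ` Gn \<subseteq> ?C"
    using k by blast
  moreover have "finite ?C"
    by simp
  ultimately show ?thesis
    by (metis inj_on_finite)
qed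

text \<open>Test graphs in \<open>Gn\<close> suffice: any other graph with at most \<open>n\<close>
  vertices has the same counts as its representative.\<close>

lemma graph_iso_of_hom_count_eq_representatives:
  assumes rep: "iso_representatives n Gn" and "G \<in> Gn" "H \<in> Gn"
    and hom: "\<And>F. F \<in> Gn \<Longrightarrow> hom_count F G = hom_count F H"
  shows "graph_iso G H"
proof (rule graph_iso_of_hom_count_eq)
  have simple: "simple_graph K" "card (verts K) \<le> n" if "K \<in> Gn" for K
    using rep that by (auto simp: iso_representatives_def graphs_upto_def)
  show GH: "simple_graph G" "card (verts G) \<le> n" "simple_graph H" "card (verts H) \<le> n"
    using simple assms(2,3) by blast+
  fix F :: "nat ugraph" assume F: "simple_graph F" "card (verts F) \<le> n"
  then obtain K where K: "K \<in> Gn" "graph_iso F K"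
    using rep unfolding iso_representatives_def graphs_upto_def by blast
  show "hom_count F G = hom_count F H"
    using hom_count_cong_iso[OF K(2) F(1) simple(1)[OF K(1)]] GH(1,3) hom[OF K(1)] by metis
qed

section \<open>Expectation of the embedding and its completeness\<close>

section \<open>Expectations of the embedding\<close>

lemma hom_embedding_component:
  assumes "i \<in> I"
  shows "hom_embedding I F G i = real (hom_count i G) * (if F = i then 1 else 0)"
  using assms by (auto simp: hom_embedding_def scale_vec_def basis_vec_def)

text \<open>Component \<open>i\<close> is a constant times the indicator of the event that
  \<open>X\<close> equals \<open>i\<close>, which has probability \<open>pmf D i\<close>. This form
  yields integrability and the value together.\<close>

lemma has_bochner_integral_hom_embedding:
  assumes "prob_space M" "X \<in> measurable M (count_space UNIV)"
    and D: "distr M (count_space UNIV) X = measure_pmf D" and i: "i \<in> I"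
  shows "has_bochner_integral M (\<lambda>\<omega>. hom_embedding I (X \<omega>) G i) (real (hom_count i G) * pmf D i)"
proof -
  interpret prob_space M by fact
  let ?A = "X -` {i} \<inter> space M"
  have A: "?A \<in> sets M"
    using assms(2) by (rule measurable_sets) simp
  have "pmf D i = measure (distr M (count_space UNIV) X) {i}"
    by (simp add: D measure_pmf_single)
  also have "\<dots> = measure M ?A"
    using assms(2) by (simp add: measure_distr)
  finally have "has_bochner_integral M (indicator ?A) (pmf D i)"
    using has_bochner_integral_real_indicator[OF A] by (simp add: emeasure_eq_measure)
  then have "has_bochner_integral M (\<lambda>\<omega>. real (hom_count i G) * indicator ?A \<omega>)
      (real (hom_count i G) * pmf D i)"
    by (intro has_bochner_integral_mult_right)
  then show ?thesis
    by (rule iffD1[OF has_bochner_integral_cong, rotated -1])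
      (auto simp: hom_embedding_component[OF i] indicator_def)
qed

theorem theorem7:
  fixes n :: nat
    and Gn :: "nat ugraph set"
    and D :: "nat ugraph pmf"
    and M :: "'w measure"
    and F :: "'w \<Rightarrow> nat ugraph"
  assumes "iso_representatives n Gn"
    and "set_pmf D \<subseteq> Gn"
    and "full_support D Gn"
    and "prob_space M"
    and "F \<in> measurable M (count_space UNIV)"
    and "distr M (count_space UNIV) F = measure_pmf D"
  shows "expectation_complete_embedding M F Gn Gn (hom_embedding Gn)
    \<and> expectation_complete_kernel M F Gn Gn (hom_embedding Gn)
        (\<lambda>f G G'. inner_vec Gn (hom_embedding Gn f G) (hom_embedding Gn f G'))"
proof -
  note integral = has_bochner_integral_hom_embedding[OF assms(4-6), of _ Gn]
  have embedding: "random_graph_embedding M F Gn Gn (hom_embedding Gn)"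
    unfolding random_graph_embedding_def
    using assms(4) finite_iso_representatives[OF assms(1)] integral
    by (auto simp: hom_embedding_def scale_vec_def has_bochner_integral_iff)
  have expect: "expectation_vec M Gn (\<lambda>\<omega>. hom_embedding Gn (F \<omega>) G) i
      = real (hom_count i G) * pmf D i" if "i \<in> Gn" for i G
    using integral[OF that] that by (simp add: expectation_vec_def has_bochner_integral_iff)
  have "complete_on Gn (\<lambda>G. expectation_vec M Gn (\<lambda>\<omega>. hom_embedding Gn (F \<omega>) G))"
    unfolding complete_on_def
  proof (intro ballI conjI impI)
    fix G H assume GH: "G \<in> Gn" "H \<in> Gn"
    show "expectation_vec M Gn (\<lambda>\<omega>. hom_embedding Gn (F \<omega>) G)
        = expectation_vec M Gn (\<lambda>\<omega>. hom_embedding Gn (F \<omega>) H)" if "graph_iso G H"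
      \<comment> \<open>Isomorphic members of \<open>Gn\<close> are equal.\<close>
      using iso_representatives_unique[OF assms(1) GH that] by simp
    show "expectation_vec M Gn (\<lambda>\<omega>. hom_embedding Gn (F \<omega>) G)
        \<noteq> expectation_vec M Gn (\<lambda>\<omega>. hom_embedding Gn (F \<omega>) H)" if "\<not> graph_iso G H"
    proof
      assume eq: "expectation_vec M Gn (\<lambda>\<omega>. hom_embedding Gn (F \<omega>) G)
        = expectation_vec M Gn (\<lambda>\<omega>. hom_embedding Gn (F \<omega>) H)"
      \<comment> \<open>Full support makes the factor \<open>pmf D i\<close> nonzero, so it
        cancels.\<close>
      have "hom_count i G = hom_count i H" if i: "i \<in> Gn" for i
        using expect[OF i, of G] expect[OF i, of H] eq assms(3) i by (simp add: full_support_def)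
      then have "graph_iso G H"
        by (rule graph_iso_of_hom_count_eq_representatives[OF assms(1) GH])
      with that show False ..
    qed
  qed
  with embedding have "expectation_complete_embedding M F Gn Gn (hom_embedding Gn)"
    by (simp add: expectation_complete_embedding_def)
  then show ?thesis
    by (simp add: expectation_complete_kernel_def kernel_of_def)
qed

end
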